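(* Let $r\ge1$ and let $u\neq v$ be vertices of the Kostka polytope $P_r$ labeled $(a,b,\ell)$ and $(a',b',\ell')$ respectively, where $a-b\le a'-b'$. Then $\{u,v\}$ is the vertex set of a face of $P_r$ (i.e. $\mathrm{conv}\{u,v\}$ is an edge) if and only if one of the following holds: (1) $a=b$ and at least one of: (i) $a'=b'$; (ii) $a=b'$; (iii) $a\ge a'$; (iv) $\ell'\ge a$; (2) $a\neq b$ and at least one of: (i) at least two of the three equalities $a=a'$, $b=b'$, $\ell=\ell'$ hold; (ii) $\ell\ge a'$; (iii) $\ell'\ge a$.
   Context: For a positive integer $r$, a partition with at most $r$ parts is written as a non-increasing $r$-tuple of nonnegative integers; $\mathrm{Par}_r(n)$ is the set of those with entries summing to $n$. For $\lambda,\mu\in\mathrm{Par}_r(n)$, $\lambda$ dominates $\mu$ if $\sum_{i=1}^k\lambda_i\ge\sum_{i=1}^k\mu_i$ for all $k\le r$. The $r$-Kostka cone $\mathcal{K}_r\subseteq\mathbb{R}^{2r}$ is the convex hull of all points $(\lambda_1,\dots,\lambda_r,\mu_1,\dots,\mu_r)$ with $\lambda,\mu\in\mathrm{Par}_r(n)$ for some $n$ and $\lambda$ dominating $\mu$. The Kostka polytope $P_r$ is $\mathcal{K}_r\cap\{x:\sum_{i=1}^r(\lambda_i+\mu_i)=1\}$, whose vertices are the intersections with the extremal rays of $\mathcal{K}_r$. It is known that the extremal rays of $\mathcal{K}_r$ are exactly the rays spanned by the vectors $\big((a-\ell)^b,0^{r-b};\,(a-\ell)^\ell,(b-\ell)^{a-\ell},0^{r-a}\big)$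 for integers $0\le\ell<b\le a\le r$, where exponents denote repetition of an entry. A vertex of $P_r$ on the ray of such a vector with $a\neq b$ (so $0\le\ell<b<a\le r$) is labeled $(a,b,\ell)$; when $a=b$ the ray does not depend on $\ell$, and the vertex is labeled $(a,a,a)$. *)

theory Defs
  imports "HOL-Analysis.Analysis"
begin

text \<open>
  The index set \<open>{1, \<dots>, r}\<close> is a finite linearly ordered type \<open>'n\<close> with \<open>r = CARD('n)\<close>, and
  \<open>\<real>\<^sup>2\<^sup>r\<close> is \<open>(real ^ 'n) \<times> (real ^ 'n)\<close>, the components holding \<open>\<lambda>\<close> and \<open>\<mu>\<close>.
\<close>

text \<open>The 1-based position of an index: the \<open>i\<close> with \<open>position i = k\<close> stands for the index \<open>k\<close>.\<close>

definition position :: "'n::{finite,linorder} \<Rightarrow> nat" where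
  "position i = card {j. j \<le> i}"

definition Par :: "nat \<Rightarrow> (nat ^ 'n::{finite,linorder}) set" where
  "Par n = {p. (\<forall>i j. i \<le> j \<longrightarrow> p $ j \<le> p $ i) \<and> (\<Sum>i\<in>UNIV. p $ i) = n}"

definition dominates :: "nat ^ 'n::{finite,linorder} \<Rightarrow> nat ^ 'n::{finite,linorder} \<Rightarrow> bool" where
  "dominates p q \<longleftrightarrow> (\<forall>k. (\<Sum>i | i \<le> k. q $ i) \<le> (\<Sum>i | i \<le> k. p $ i))"

definition kostka_point ::
    "nat ^ 'n::{finite,linorder} \<Rightarrow> nat ^ 'n::{finite,linorder} \<Rightarrow>
      (real ^ 'n::{finite,linorder}) \<times> (real ^ 'n::{finite,linorder})" where
  "kostka_point p q = ((\<chi> i. real (p $ i)), (\<chi> i. real (q $ i)))"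

definition kostka_cone :: "((real ^ 'n::{finite,linorder}) \<times> (real ^ 'n::{finite,linorder})) set" where
  "kostka_cone =
     convex hull {kostka_point p q | p q n. p \<in> Par n \<and> q \<in> Par n \<and> dominates p q}"

definition kostka_polytope :: "((real ^ 'n::{finite,linorder}) \<times> (real ^ 'n::{finite,linorder})) set" where
  "kostka_polytope = kostka_cone \<inter> {(x, y). (\<Sum>i\<in>UNIV. x $ i + y $ i) = 1}"

definition ray_vector ::
    "nat \<Rightarrow> nat \<Rightarrow> nat \<Rightarrow> (real ^ 'n::{finite,linorder}) \<times> (real ^ 'n::{finite,linorder})" where
  "ray_vector a b l =
     ((\<chi> i. if position i \<le> b then real a - real l else 0),
      (\<chi> i. if position i \<le> l then real a - real l
            else if position i \<le> a then real b - real l else 0))"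

text \<open>
  For \<open>a = b\<close> all vectors \<open>ray_vector a a m\<close> with \<open>m < a\<close> span the same ray, whose label is
  \<open>(a, a, a)\<close>.
\<close>

definition labeled ::
    "(real ^ 'n::{finite,linorder}) \<times> (real ^ 'n::{finite,linorder})
      \<Rightarrow> nat \<times> nat \<times> nat \<Rightarrow> bool" where
  "labeled v = (\<lambda>(a, b, l).
     (l < b \<and> b < a \<and> a \<le> CARD('n) \<and> v \<in> cone hull {ray_vector a b l}) \<or>
     (b = a \<and> l = a \<and> a \<le> CARD('n) \<and> (\<exists>m<a. v \<in> cone hull {ray_vector a a m})))"

end

theory Submission
  imports Defs
begin

text \<open>
  Write \<open>\<lambda> = \<Sum>\<^sub>k p\<^sub>k \<omega>\<^sub>k\<close> and \<open>\<mu> = \<Sum>\<^sub>k q\<^sub>k \<omega>\<^sub>k\<close> with \<open>\<omega>\<^sub>k = (1\<^sup>k, 0, \<dots>, 0)\<close>, and let \<open>D\<^sub>k\<close> be the difference of the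
  \<open>k\<close>-th prefix sums of \<open>\<lambda>\<close> and \<open>\<mu>\<close>. The Kostka cone is cut out by \<open>p, q, D \<ge> 0\<close> and \<open>D\<^sub>r = 0\<close>, and
  the second difference of \<open>D\<close> is \<open>q - p\<close>. The vertex \<open>(a, b, l)\<close> has \<open>p\<close> supported on \<open>{b}\<close>, \<open>q\<close> on
  \<open>{l, a}\<close> and \<open>D\<close> on the open interval from \<open>l\<close> to \<open>a\<close>. Given any nonzero point and \<open>b\<close> with \<open>p\<^sub>b > 0\<close>, let
  \<open>l\<close> and \<open>a\<close> be the nearest points of the support of \<open>q\<close> around \<open>b\<close> (with \<open>l = 0\<close> if there is none below):
  \<open>D\<close> is concave between them, hence positive, so the vertex \<open>(a, b, l)\<close> lies in the smallest face
  containing the point. Thus these are all vertices, and \<open>u, v\<close> span an edge iff no third label has its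
  supports inside the union of those of \<open>u\<close> and \<open>v\<close>, which is a question about integer intervals.
\<close>

section \<open>Prefix sums and their differences\<close>

type_synonym 'n point = "(real, 'n) vec \<times> (real, 'n) vec"

lemma position_strict_mono: "i < j \<Longrightarrow> position i < position (j :: 'n::{finite,linorder})"
  unfolding position_def by (rule psubset_card_mono) (auto, metis leD mem_Collect_eq order_refl)

lemma position_le_iff: "position i \<le> position j \<longleftrightarrow> i \<le> (j :: 'n::{finite,linorder})"
  by (metis leD leI order.order_iff_strict position_strict_mono)

text \<open>An injection into a set of the same cardinality is onto. This lets indices of type
  \<open>'n\<close> be traded for the numbers from 1 to r.\<close>

lemma bij_betw_position: "bij_betw position (UNIV :: 'n::{finite,linorder} set) {1..CARD('n)}"
proof -
  have inj: "inj (position :: 'n \<Rightarrow> nat)"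
    by (rule injI) (metis order_antisym order_refl position_le_iff)
  have "position ` (UNIV :: 'n set) \<subseteq> {1..CARD('n)}"
    by (auto simp: position_def card_gt_0_iff Suc_le_eq intro!: card_mono)
  moreover have "card (position ` (UNIV :: 'n set)) = card {1..CARD('n)}"
    using inj by (simp add: card_image)
  ultimately have "position ` (UNIV :: 'n set) = {1..CARD('n)}"
    by (intro card_subset_eq) auto
  with inj show ?thesis by (simp add: bij_betw_def)
qed

lemma position_in: "position (i :: 'n::{finite,linorder}) \<in> {1..CARD('n)}"
  using bij_betw_position by (auto simp: bij_betw_def)

lemma position_inject: "position i = position j \<longleftrightarrow> i = (j :: 'n::{finite,linorder})"
  by (metis order_antisym order_refl position_le_iff)

lemma ex_position:
  assumes "1 \<le> k" "k \<le> CARD('n)"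
  obtains i :: "'n::{finite,linorder}" where "position i = k"
proof -
  have "k \<in> position ` (UNIV :: 'n set)"
    using bij_betw_position[where 'n='n] assms by (auto simp: bij_betw_def)
  then show thesis using that by blast
qed

lemma card_position_le: "card {i :: 'n::{finite,linorder}. position i \<le> k} = min k CARD('n)"
proof -
  have "position ` {i :: 'n. position i \<le> k} = {1..min k CARD('n)}"
    using bij_betw_position[where 'n='n] by (force simp: bij_betw_def)
  moreover have "inj_on position {i :: 'n. position i \<le> k}"
    by (auto intro: inj_onI simp: position_inject)
  ultimately show ?thesis by (metis card_image card_atLeastAtMost diff_Suc_1)
qed

text \<open>The index is a natural number, so that 0 and numbers beyond the dimension are allowed;
  there the value is 0 and the full total, which gives \<open>mass\<close> and \<open>gap\<close>
  their boundary behaviour.\<close>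

definition prefix_sum :: "real ^ 'n::{finite,linorder} \<Rightarrow> nat \<Rightarrow> real" where
  "prefix_sum x k = (\<Sum>i | position i \<le> k. x $ i)"

text \<open>\<open>mass x k\<close> is the difference \<open>x\<^sub>k - x\<^sub>k\<^sub>+\<^sub>1\<close> (with \<open>x\<^sub>k = 0\<close> for \<open>k\<close> larger than the dimension),
  i.e. the coefficient of \<open>x\<close> at the fundamental weight \<open>(1\<^sup>k, 0, \<dots>, 0)\<close>.\<close>

definition mass :: "real ^ 'n::{finite,linorder} \<Rightarrow> nat \<Rightarrow> real" where
  "mass x k = 2 * prefix_sum x k - prefix_sum x (k - 1) - prefix_sum x (Suc k)"

text \<open>The slack \<open>D_k\<close> of the k-th dominance inequality.\<close>

definition gap :: "'n::{finite,linorder} point \<Rightarrow> nat \<Rightarrow> real" where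
  "gap w k = prefix_sum (fst w) k - prefix_sum (snd w) k"

lemma prefix_sum_add: "prefix_sum (x + y) k = prefix_sum x k + prefix_sum y k"
  by (simp add: prefix_sum_def sum.distrib)

lemma prefix_sum_scaleR: "prefix_sum (c *\<^sub>R x) k = c * prefix_sum x k"
  by (simp add: prefix_sum_def sum_distrib_left)

lemma prefix_sum_diff: "prefix_sum (x - y) k = prefix_sum x k - prefix_sum y k"
  by (simp add: prefix_sum_def sum_subtractf)

lemma mass_add: "mass (x + y) k = mass x k + mass y k"
  by (simp add: mass_def prefix_sum_add)

lemma mass_diff: "mass (x - y) k = mass x k - mass y k"
  by (simp add: mass_def prefix_sum_diff)

lemma mass_scaleR: "mass (c *\<^sub>R x) k = c * mass x k"
  by (simp add: mass_def prefix_sum_scaleR algebra_simps)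

lemma gap_add: "gap (w + z) k = gap w k + gap z k"
  by (simp add: gap_def prefix_sum_add)

lemma gap_diff: "gap (w - z) k = gap w k - gap z k"
  by (simp add: gap_def prefix_sum_diff)

lemma gap_scaleR: "gap (c *\<^sub>R w) k = c * gap w k"
  by (simp add: gap_def prefix_sum_scaleR algebra_simps)

lemmas functional_simps = prefix_sum_add prefix_sum_diff prefix_sum_scaleR
  mass_add mass_diff mass_scaleR gap_add gap_diff gap_scaleR

lemma prefix_sum_0: "prefix_sum x 0 = 0"
proof -
  have "\<not> position i \<le> 0" for i :: 'a
    using position_in[of i] by simp
  then show ?thesis by (simp only: prefix_sum_def Collect_empty_eq sum.empty) simp
qed

lemma prefix_sum_top:
  fixes x :: "real ^ 'n::{finite,linorder}"
  assumes "CARD('n) \<le> k"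
  shows "prefix_sum x k = (\<Sum>i\<in>UNIV. x $ i)"
proof -
  have "position i \<le> k" for i :: 'n
    using position_in[of i] assms by simp
  then show ?thesis by (simp add: prefix_sum_def)
qed

lemma prefix_sum_position:
  "prefix_sum x (position i) = prefix_sum x (position i - 1) + x $ i"
proof -
  have "{j. position j \<le> position i} = insert i {j. position j \<le> position i - 1}"
    using position_in[of i] by (auto simp: position_inject[symmetric])
  moreover have "i \<notin> {j. position j \<le> position i - 1}"
    using position_in[of i] by auto
  ultimately show ?thesis by (simp add: prefix_sum_def)
qed

definition weight :: "nat \<Rightarrow> real ^ 'n::{finite,linorder}" where
  "weight b = (\<chi> i. if position i \<le> b then 1 else 0)"

lemma prefix_sum_weight:
  assumes "b \<le> CARD('n)"
  shows "prefix_sum (weight b :: real ^ 'n::{finite,linorder}) k = real (min k b)"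
proof -
  have "prefix_sum (weight b :: (real, 'n) vec) k = (\<Sum>i :: 'n | position i \<le> min k b. 1)"
    unfolding prefix_sum_def weight_def
    by (rule sum.mono_neutral_cong_right) auto
  then show ?thesis using assms card_position_le[of "min k b", where 'n='n] by (simp del: min.bounded_iff)
qed

text \<open>The prefix sums min k b are linear on both sides of b and have their only kink there.
  Index 0 is excluded because \<open>k - 1\<close> is truncated.\<close>

lemma mass_weight:
  assumes "b \<le> CARD('n)" "1 \<le> k"
  shows "mass (weight b :: real ^ 'n::{finite,linorder}) k = (if k = b then 1 else 0)"
proof -
  consider "k < b" | "k = b" | "b < k" by linarith
  then show ?thesis
    using assms by cases (auto simp: mass_def prefix_sum_weight min_def of_nat_diff)
qed

section \<open>The polytope in terms of inequalities\<close>

text \<open>The candidate description by inequalities, later shown to equal the polytope. Equal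
  totals of the two halves and overall total 1 give 1/2 for each half.\<close>

definition slice :: "'n::{finite,linorder} point set" where
  "slice = {w. prefix_sum (fst w) CARD('n) = 1 / 2 \<and> prefix_sum (snd w) CARD('n) = 1 / 2 \<and>
     (\<forall>k\<in>{1..CARD('n)}. 0 \<le> mass (fst w) k \<and> 0 \<le> mass (snd w) k \<and> 0 \<le> gap w k)}"

text \<open>For points of \<open>slice\<close> this says that \<open>w\<close> lies in the smallest
  face containing \<open>z\<close>.\<close>

definition supported_by ::
    "'n::{finite,linorder} point
      \<Rightarrow> 'n::{finite,linorder} point \<Rightarrow> bool" where
  "supported_by w z \<longleftrightarrow> (\<forall>k\<in>{1..CARD('n)}.
     (mass (fst z) k = 0 \<longrightarrow> mass (fst w) k = 0) \<and>
     (mass (snd z) k = 0 \<longrightarrow> mass (snd w) k = 0) \<and>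
     (gap z k = 0 \<longrightarrow> gap w k = 0))"

text \<open>Where \<open>f\<close> is positive, a small multiple of \<open>g\<close> fits below it;
  where \<open>f\<close> vanishes, so does \<open>g\<close>. The bound is uniform in
  \<open>d\<close>, so the minimum of several such \<open>e\<close> works for all of them.\<close>

lemma ex_small_multiple:
  fixes f g :: "'a \<Rightarrow> real"
  assumes "finite J" "\<And>j. j \<in> J \<Longrightarrow> 0 \<le> f j" "\<And>j. j \<in> J \<Longrightarrow> f j = 0 \<Longrightarrow> g j = 0"
  shows "\<exists>e>0. e < 1 \<and> (\<forall>j\<in>J. \<forall>d. 0 \<le> d \<and> d \<le> e \<longrightarrow> d * g j \<le> f j)"
  using assms
proof (induction J)
  case empty
  show ?case by (rule exI[of _ "1/2"]) auto
next
  case (insert j J)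
  then obtain e where e: "e > 0" "e < 1" "\<forall>j\<in>J. \<forall>d. 0 \<le> d \<and> d \<le> e \<longrightarrow> d * g j \<le> f j"
    by auto
  \<comment> \<open>Only a positive \<open>g j\<close> restricts \<open>d\<close>; otherwise
    \<open>d * g j\<close> is nonpositive and any positive constant will do.\<close>
  define c where "c = (if g j > 0 then f j / g j else 1)"
  have c: "c > 0"
    using insert.prems(1)[of j] insert.prems(2)[of j] by (auto simp: c_def less_le)
  have "d * g j \<le> f j" if "0 \<le> d" "d \<le> c" for d
  proof (cases "g j > 0")
    case True
    then show ?thesis using that by (simp add: c_def field_simps)
  next
    case False
    then show ?thesis using that insert.prems(1)[of j]
      by (metis insertI1 mult_nonneg_nonpos not_less order_trans)
  qed
  with e c show ?case by (intro exI[of _ "min e c"]) auto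
qed

text \<open>Moving from \<open>z\<close> a little way straight away from \<open>w\<close> stays in
  \<open>slice\<close>: the inequalities strict at \<open>z\<close> tolerate a small change, and
  those tight at \<open>z\<close> are tight at \<open>w\<close> and hence stay tight.\<close>

lemma supported_by_decompose:
  fixes w z :: "'n::{finite,linorder} point"
  assumes w: "w \<in> slice" and z: "z \<in> slice" and s: "supported_by w z"
  obtains e t where "0 < e" "e < 1" "t \<in> slice" "z = e *\<^sub>R w + (1 - e) *\<^sub>R t"
proof -
  let ?K = "{1..CARD('n)}"
  obtain e1 where e1: "e1 > 0" "e1 < 1"
      "\<forall>k\<in>?K. \<forall>d. 0 \<le> d \<and> d \<le> e1 \<longrightarrow> d * mass (fst w) k \<le> mass (fst z) k"
    using ex_small_multiple[of ?K "mass (fst z)" "mass (fst w)"] z s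
    by (auto simp: slice_def supported_by_def)
  obtain e2 where e2: "e2 > 0" "e2 < 1"
      "\<forall>k\<in>?K. \<forall>d. 0 \<le> d \<and> d \<le> e2 \<longrightarrow> d * mass (snd w) k \<le> mass (snd z) k"
    using ex_small_multiple[of ?K "mass (snd z)" "mass (snd w)"] z s
    by (auto simp: slice_def supported_by_def)
  obtain e3 where e3: "e3 > 0" "e3 < 1"
      "\<forall>k\<in>?K. \<forall>d. 0 \<le> d \<and> d \<le> e3 \<longrightarrow> d * gap w k \<le> gap z k"
    using ex_small_multiple[of ?K "gap z" "gap w"] z s
    by (auto simp: slice_def supported_by_def)
  define e where "e = min e1 (min e2 e3)"
  have e: "0 < e" "e < 1" using e1 e2 e3 by (auto simp: e_def)
  \<comment> \<open>The solution of \<open>z = e w + (1 - e) t\<close>; its inequalities are exactly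
    the bounds in \<open>le\<close>.\<close>
  define t where "t = (1 / (1 - e)) *\<^sub>R (z - e *\<^sub>R w)"
  have le: "e * mass (fst w) k \<le> mass (fst z) k" "e * mass (snd w) k \<le> mass (snd z) k"
      "e * gap w k \<le> gap z k" if "k \<in> ?K" for k
    using that e e1(3) e2(3) e3(3) by (auto simp: e_def)
  have "t \<in> slice"
    using w z e le unfolding slice_def t_def
    by (simp add: functional_simps diff_divide_eq_iff divide_eq_eq zero_le_divide_iff)
  moreover have "z = e *\<^sub>R w + (1 - e) *\<^sub>R t"
    using e by (simp add: t_def)
  ultimately show thesis using that e by blast
qed

text \<open>A minimum principle: at an interior zero, concavity bounds the sum of the two
  nonnegative neighbours by 0, so both vanish, and the zero spreads up to both ends.\<close>

lemma zero_propagates: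
  fixes g :: "nat \<Rightarrow> real"
  assumes nonneg: "\<And>k. 0 \<le> g k"
    and conc: "\<And>k. m < k \<Longrightarrow> k < n \<Longrightarrow> g (k - 1) + g (Suc k) \<le> 2 * g k"
    and c: "m < c" "c < n" "g c = 0"
    and k: "m \<le> k" "k \<le> n"
  shows "g k = 0"
proof -
  have nbr: "g (j - 1) = 0 \<and> g (Suc j) = 0" if "m < j" "j < n" "g j = 0" for j
    using conc[OF that(1,2)] that(3) nonneg[of "j - 1"] nonneg[of "Suc j"] by linarith
  show ?thesis
  proof (cases "c \<le> k")
    case True
    then show ?thesis using k(2)
    proof (induction k rule: dec_induct)
      case (step j)
      then have "m < j" "j < n" "g j = 0" using c by auto
      then show ?case using nbr[of j] by simp
    qed (use c in simp)
  next
    case False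
    then have "k \<le> c" by simp
    then show ?thesis using k(1)
    proof (induction k rule: inc_induct)
      case (step j)
      then have "g (Suc j) = 0" "m < Suc j" "Suc j < n" using c by auto
      then show ?case using nbr[of "Suc j"] by simp
    qed (use c in simp)
  qed
qed

lemma gap_second_difference:
  "gap w (k - 1) + gap w (Suc k) = 2 * gap w k - mass (fst w) k + mass (snd w) k"
  by (simp add: gap_def mass_def)

section \<open>Vertices\<close>

definition is_label :: "nat \<Rightarrow> nat \<Rightarrow> nat \<Rightarrow> nat \<Rightarrow> bool" where
  "is_label r a b l \<longleftrightarrow> (l < b \<and> b < a \<or> 0 < a \<and> b = a \<and> l = a) \<and> a \<le> r"

text \<open>The factor is one over twice the sum \<open>b (a - l)\<close> of the first component, so
  that each half sums to 1/2. The case \<open>a = b\<close> is separate because its label has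
  \<open>l = a\<close>, for which \<open>ray_vector\<close> is zero.\<close>

definition vertex ::
    "nat \<Rightarrow> nat \<Rightarrow> nat \<Rightarrow> 'n::{finite,linorder} point" where
  "vertex a b l =
     (if a = b then (1 / (2 * real a)) *\<^sub>R (weight a, weight a)
      else (1 / (2 * real b * (real a - real l))) *\<^sub>R ray_vector a b l)"

lemma ray_vector_eq:
  assumes "l \<le> a"
  shows "ray_vector a b l =
    ((real a - real l) *\<^sub>R weight b, (real a - real b) *\<^sub>R weight l + (real b - real l) *\<^sub>R weight a)"
  using assms by (auto simp: ray_vector_def weight_def vec_eq_iff)

text \<open>A tent over the interval from \<open>l\<close> to \<open>a\<close> with its peak at
  \<open>b\<close>.\<close>

lemma gap_ray_vector:
  assumes "l < b" "b < a" "a \<le> CARD('n)"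
  shows "gap (ray_vector a b l :: 'n::{finite,linorder} point) k =
    (if k \<le> l \<or> a \<le> k then 0
     else if k \<le> b then (real a - real b) * (real k - real l)
     else (real b - real l) * (real a - real k))"
  using assms
  by (auto simp: gap_def ray_vector_eq functional_simps prefix_sum_weight min_def) (simp_all add: algebra_simps)

text \<open>Which inequalities are tight at a vertex. For \<open>l = 0\<close> the vector
  \<open>weight l\<close> is zero, in accordance with \<open>1 \<le> k\<close>; for
  \<open>a = b = l\<close> the two halves agree and the open interval is empty.\<close>

lemma
  assumes "is_label CARD('n) a b l" "1 \<le> k"
  shows mass_fst_vertex: "mass (fst (vertex a b l :: 'n::{finite,linorder} point)) k \<ge> 0"
      "mass (fst (vertex a b l :: 'n::{finite,linorder} point)) k = 0 \<longleftrightarrow> k \<noteq> b"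
    and mass_snd_vertex: "mass (snd (vertex a b l :: 'n::{finite,linorder} point)) k \<ge> 0"
      "mass (snd (vertex a b l :: 'n::{finite,linorder} point)) k = 0 \<longleftrightarrow> k \<noteq> a \<and> k \<noteq> l"
    and gap_vertex: "gap (vertex a b l :: 'n::{finite,linorder} point) k \<ge> 0"
      "gap (vertex a b l :: 'n::{finite,linorder} point) k = 0 \<longleftrightarrow> \<not> (l < k \<and> k < a)"
proof -
  let ?v = "vertex a b l :: 'n point"
  have "mass (fst ?v) k \<ge> 0 \<and> (mass (fst ?v) k = 0 \<longleftrightarrow> k \<noteq> b) \<and>
    mass (snd ?v) k \<ge> 0 \<and> (mass (snd ?v) k = 0 \<longleftrightarrow> k \<noteq> a \<and> k \<noteq> l) \<and>
    gap ?v k \<ge> 0 \<and> (gap ?v k = 0 \<longleftrightarrow> \<not> (l < k \<and> k < a))"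
  proof (cases "a = b")
    case True
    then show ?thesis using assms
      by (auto simp: is_label_def vertex_def functional_simps mass_weight gap_def)
  next
    case False
    then have lab: "l < b" "b < a" "a \<le> CARD('n)" using assms by (auto simp: is_label_def)
    define c where "c = 1 / (2 * real b * (real a - real l))"
    have c: "c > 0" using lab by (simp add: c_def)
    have v: "?v = c *\<^sub>R ray_vector a b l" using False by (simp add: vertex_def c_def)
    have "mass (fst ?v) k = c * (if k = b then real a - real l else 0)"
      using lab assms(2) by (simp add: v ray_vector_eq functional_simps mass_weight)
    moreover have "mass (snd ?v) k = c * (if k = l then real a - real b else if k = a then real b - real l else 0)"
      using lab assms(2) by (simp add: v ray_vector_eq functional_simps mass_weight)
    moreover have "gap ?v k = c * (if k \<le> l \<or> a \<le> k then 0
     else if k \<le> b then (real a - real b) * (real k - real l)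
     else (real b - real l) * (real a - real k))"
      using lab by (simp add: v gap_scaleR gap_ray_vector)
    ultimately show ?thesis using lab c by auto
  qed
  then show "mass (fst ?v) k \<ge> 0" "mass (fst ?v) k = 0 \<longleftrightarrow> k \<noteq> b"
    "mass (snd ?v) k \<ge> 0" "mass (snd ?v) k = 0 \<longleftrightarrow> k \<noteq> a \<and> k \<noteq> l"
    "gap ?v k \<ge> 0" "gap ?v k = 0 \<longleftrightarrow> \<not> (l < k \<and> k < a)" by auto
qed

lemma vertex_in_slice:
  assumes "is_label CARD('n) a b l"
  shows "(vertex a b l :: 'n::{finite,linorder} point) \<in> slice"
proof -
  let ?v = "vertex a b l :: 'n point"
  have 1: "prefix_sum (fst ?v) CARD('n) = 1 / 2"
    using assms by (auto simp: is_label_def vertex_def ray_vector_eq functional_simps prefix_sum_weight)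
  have "gap ?v CARD('n) = 0"
    using assms gap_vertex(2)[OF assms, of "CARD('n)"] by (auto simp: is_label_def)
  with 1 have 2: "prefix_sum (snd ?v) CARD('n) = 1 / 2"
    by (simp add: gap_def)
  show ?thesis
    using 1 2 mass_fst_vertex(1)[OF assms] mass_snd_vertex(1)[OF assms] gap_vertex(1)[OF assms]
    by (auto simp: slice_def)
qed

text \<open>The label is read off the supports of \<open>w\<close>. If both components have mass at
  \<open>b\<close>, the degenerate label \<open>(b, b, b)\<close> works; otherwise \<open>l\<close>
  and \<open>a\<close> are the nearest support points of the second component, and strict concavity
  keeps the gap positive between them.\<close>

lemma ex_vertex_supported_by:
  fixes w :: "'n::{finite,linorder} point"
  assumes w: "w \<in> slice"
  obtains a b l where "is_label CARD('n) a b l" "supported_by (vertex a b l) w"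
proof -
  let ?r = "CARD('n)" and ?p = "mass (fst w)" and ?q = "mass (snd w)"
  have top: "prefix_sum x k = prefix_sum x ?r" if "?r \<le> k" for x :: "(real, 'n) vec" and k
    using that by (simp add: prefix_sum_top)
  have gap0: "gap w k = 0" if "k = 0 \<or> ?r \<le> k" for k
    using that w top[of k] by (auto simp: gap_def prefix_sum_0 slice_def)
  have gap: "gap w k \<ge> 0" for k
  proof (cases "k = 0 \<or> ?r \<le> k")
    case False
    then have "k \<in> {1..?r}" by auto
    then show ?thesis using w unfolding slice_def by blast
  qed (simp add: gap0)
  have q_nonneg: "?q k \<ge> 0" and p_nonneg: "?p k \<ge> 0" if "k \<in> {1..?r}" for k
    using w that unfolding slice_def by blast+
  have "\<exists>b\<in>{1..?r}. ?p b > 0"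
  proof (rule ccontr)
    assume "\<not> ?thesis"
    then have p0: "?p k = 0" if "k \<in> {1..?r}" for k
      using p_nonneg[OF that] that by force
    \<comment> \<open>Without mass the prefix sums are affine; being constant beyond the dimension
      they are constant throughout, hence 0, against the total 1/2.\<close>
    have "prefix_sum (fst w) k = prefix_sum (fst w) (Suc k)" if "k \<le> ?r" for k
      using that
    proof (induction k rule: inc_induct)
      case base
      show ?case using top[of "Suc ?r" "fst w"] by simp
    next
      case (step k)
      then show ?case using p0[of "Suc k"] by (simp add: mass_def)
    qed
    then have "prefix_sum (fst w) k = 0" if "k \<le> ?r" for k
      using that by (induction k) (auto simp: prefix_sum_0)
    then show False using w by (simp add: slice_def)
  qed
  then obtain b where b: "1 \<le> b" "b \<le> ?r" "?p b > 0" by auto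
  show thesis
  proof (cases "?q b > 0")
    case True
    have lab: "is_label ?r b b b" using b by (simp add: is_label_def)
    have "supported_by (vertex b b b) w"
      unfolding supported_by_def using b True
      by (auto simp: mass_fst_vertex[OF lab] mass_snd_vertex[OF lab] gap_vertex[OF lab])
    then show thesis using that lab by blast
  next
    case False
    then have qb: "?q b = 0" using q_nonneg[of b] b by simp
    \<comment> \<open>Admitting \<open>k = 0\<close> keeps the set nonempty and yields
      \<open>l = 0\<close> if there is no mass of the second component below
      \<open>b\<close>.\<close>
    define l where "l = Max {k. k < b \<and> (k = 0 \<or> ?q k > 0)}"
    have fin: "finite {k. k < b \<and> (k = 0 \<or> ?q k > 0)}"
      by (rule finite_subset[of _ "{..<b}"]) auto
    have ne: "{k. k < b \<and> (k = 0 \<or> ?q k > 0)} \<noteq> {}" using b by (auto intro!: exI[of _ 0])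
    have l: "l < b" "l = 0 \<or> ?q l > 0"
      using Max_in[OF fin ne] by (auto simp: l_def)
    have ql: "?q k = 0" if "l < k" "k < b" for k
    proof (rule ccontr)
      assume "?q k \<noteq> 0"
      then have "?q k > 0" using q_nonneg[of k] that b by simp
      then have "k \<le> l" unfolding l_def using that by (intro Max_ge[OF fin]) auto
      with that show False by simp
    qed
    \<comment> \<open>The gap is concave between \<open>m\<close> and \<open>n\<close>, so a zero
      would spread to \<open>b\<close> and its neighbours; but at \<open>b\<close>, where
      \<open>?p b > 0\<close> and \<open>?q b = 0\<close>, the concavity is strict. Taking
      \<open>n = Suc ?r\<close> is allowed because only indices below \<open>n\<close>
      enter.\<close>
    have no_zero: "gap w c > 0"
      if "m < b" "b < n" "m < c" "c < n" and q: "\<And>k. m < k \<Longrightarrow> k < n \<Longrightarrow> ?q k = 0" and "n \<le> Suc ?r"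
      for m n c
    proof (rule ccontr)
      assume "\<not> ?thesis"
      then have c0: "gap w c = 0" using gap[of c] by simp
      have conc: "gap w (k - 1) + gap w (Suc k) \<le> 2 * gap w k" if "m < k" "k < n" for k
        using q[OF that] p_nonneg[of k] that \<open>n \<le> Suc ?r\<close> gap_second_difference[of w k] by simp
      have "gap w k = 0" if "m \<le> k" "k \<le> n" for k
        using zero_propagates[of "gap w" m n c k, OF gap conc] that c0 \<open>m < c\<close> \<open>c < n\<close> by blast
      then have "gap w (b - 1) = 0" "gap w b = 0" "gap w (Suc b) = 0"
        using \<open>m < b\<close> \<open>b < n\<close> by auto
      then show False using gap_second_difference[of w b] qb b by simp
    qed
    \<comment> \<open>Otherwise the window from \<open>b - 1\<close> to \<open>Suc ?r\<close>
      contains no mass of the second component and has \<open>?r\<close> in its interior, so the gap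
      would be positive at \<open>?r\<close>, where it is 0.\<close>
    have "\<exists>a. b < a \<and> a \<le> ?r \<and> ?q a > 0"
    proof (rule ccontr)
      assume neg: "\<not> ?thesis"
      have "?q k = 0" if "b - 1 < k" "k < Suc ?r" for k
      proof (cases "k = b")
        case False
        then have "b < k" "k \<le> ?r" using that by auto
        with neg have "\<not> ?q k > 0" by blast
        then show ?thesis using q_nonneg[of k] \<open>b < k\<close> \<open>k \<le> ?r\<close> by simp
      qed (use qb in simp)
      then have "gap w ?r > 0" using b by (intro no_zero[of "b - 1" "Suc ?r"]) auto
      then show False using gap0[of ?r] by simp
    qed
    then obtain a0 where a0: "b < a0 \<and> a0 \<le> ?r \<and> ?q a0 > 0" by blast
    define a where "a = (LEAST a. b < a \<and> a \<le> ?r \<and> ?q a > 0)"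
    have a: "b < a" "a \<le> ?r" "?q a > 0"
      using LeastI[of "\<lambda>a. b < a \<and> a \<le> ?r \<and> ?q a > 0", OF a0] by (auto simp: a_def)
    have qa: "?q k = 0" if "b < k" "k < a" for k
      using not_less_Least[of k "\<lambda>a. b < a \<and> a \<le> ?r \<and> ?q a > 0"] that a q_nonneg[of k]
      by (force simp: a_def[symmetric])
    have "?q k = 0" if "l < k" "k < a" for k
      using ql qa qb that by (metis linorder_neqE_nat)
    then have pos: "gap w k > 0" if "l < k" "k < a" for k
      using no_zero[of l a k] that l a by simp
    have lab: "is_label ?r a b l" using a l by (simp add: is_label_def)
    have "supported_by (vertex a b l) w"
      unfolding supported_by_def
    proof (intro ballI conjI impI)
      fix k assume "k \<in> {1..?r}"
      then have k: "1 \<le> k" by simp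
      show "mass (fst (vertex a b l :: 'n point)) k = 0" if "?p k = 0"
        using that b(3) by (auto simp: mass_fst_vertex(2)[OF lab k])
      show "mass (snd (vertex a b l :: 'n point)) k = 0" if "?q k = 0"
        using that a(3) l(2) k by (auto simp: mass_snd_vertex(2)[OF lab k])
      show "gap (vertex a b l :: 'n point) k = 0" if "gap w k = 0"
        using that pos[of k] by (auto simp: gap_vertex(2)[OF lab k])
    qed
    then show thesis using that lab by blast
  qed
qed

section \<open>Convexity, compactness and extreme points of the slice\<close>

lemma convex_slice: "convex slice"
proof (rule convexI)
  fix w z :: "'a point" and c d :: real
  assume wz: "w \<in> slice" "z \<in> slice" and cd: "0 \<le> c" "0 \<le> d" "c + d = 1"
  have half: "prefix_sum (fst w) CARD('a) = 1 / 2" "prefix_sum (snd w) CARD('a) = 1 / 2"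
    "prefix_sum (fst z) CARD('a) = 1 / 2" "prefix_sum (snd z) CARD('a) = 1 / 2"
    using wz unfolding slice_def by blast+
  have "c * (1 / 2) + d * (1 / 2) = 1 / 2" using cd(3) by linarith
  then show "c *\<^sub>R w + d *\<^sub>R z \<in> slice"
    using wz cd(1,2)
    unfolding slice_def mem_Collect_eq fst_add snd_add fst_scaleR snd_scaleR functional_simps half
    by simp
qed

lemma closed_slice: "closed (slice :: 'n::{finite,linorder} point set)"
proof -
  have eq: "slice = {w :: 'n point. prefix_sum (fst w) CARD('n) = 1 / 2} \<inter>
      {w. prefix_sum (snd w) CARD('n) = 1 / 2} \<inter>
      (\<Inter>k\<in>{1..CARD('n)}. {w. 0 \<le> mass (fst w) k} \<inter> {w. 0 \<le> mass (snd w) k} \<inter> {w. 0 \<le> gap w k})"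
    by (auto simp: slice_def)
  show ?thesis
    unfolding eq mass_def gap_def prefix_sum_def
    by (intro closed_Int closed_INT ballI closed_Collect_eq closed_Collect_le continuous_intros)
qed

text \<open>The entries are the increments of the prefix sums. Beyond the dimension the increment is
  0, and each step downwards adds a nonnegative mass.\<close>

lemma nonneg_of_mass_nonneg:
  fixes x :: "real ^ 'n::{finite,linorder}"
  assumes "\<And>k. k \<in> {1..CARD('n)} \<Longrightarrow> 0 \<le> mass x k"
  shows "0 \<le> x $ i"
proof -
  have "prefix_sum x k \<le> prefix_sum x (Suc k)" if "k \<le> CARD('n)" for k
    using that
  proof (induction k rule: inc_induct)
    case base
    show ?case by (simp add: prefix_sum_top)
  next
    case (step k)
    then show ?case using assms[of "Suc k"] by (simp add: mass_def)
  qed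
  from this[of "position i - 1"] show ?thesis
    using prefix_sum_position[of x i] position_in[of i] by (simp add: le_diff_conv)
qed

text \<open>Entries are nonnegative, so the norm of each half is at most its sum 1/2.\<close>

lemma compact_slice: "compact (slice :: 'n::{finite,linorder} point set)"
proof -
  have half: "norm x \<le> 1 / 2"
    if "prefix_sum x CARD('n) = 1 / 2" "\<And>k. k \<in> {1..CARD('n)} \<Longrightarrow> 0 \<le> mass x k" for x :: "(real, 'n) vec"
  proof -
    have "norm x \<le> (\<Sum>i\<in>UNIV. \<bar>x $ i\<bar>)" by (rule norm_le_l1_cart)
    also have "\<dots> = (\<Sum>i\<in>UNIV. x $ i)" using nonneg_of_mass_nonneg[OF that(2)] by simp
    also have "\<dots> = 1 / 2" using that(1) by (simp add: prefix_sum_top)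
    finally show ?thesis .
  qed
  have "norm w \<le> 1" if "w \<in> slice" for w :: "'n point"
  proof -
    have "norm (fst w) \<le> 1 / 2" "norm (snd w) \<le> 1 / 2"
      using that unfolding slice_def by (blast intro: half)+
    then show ?thesis using norm_Pair_le[of "fst w" "snd w"] by simp
  qed
  then have "bounded (slice :: 'n point set)" unfolding bounded_iff by blast
  then show ?thesis using closed_slice compact_eq_bounded_closed by blast
qed

text \<open>Some vertex is supported by \<open>w\<close>, and the decomposition then makes
  \<open>w\<close> an inner point of a segment starting at that vertex, unless the segment is a
  single point.\<close>

lemma extreme_point_of_slice:
  fixes w :: "'n::{finite,linorder} point"
  assumes w: "w extreme_point_of slice"
  obtains a b l where "is_label CARD('n) a b l" "w = vertex a b l"
proof -
  have mem: "w \<in> slice" using w by (simp add: extreme_point_of_def)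
  obtain a b l where lab: "is_label CARD('n) a b l" and s: "supported_by (vertex a b l) w"
    using ex_vertex_supported_by[OF mem] .
  obtain e t where et: "0 < e" "e < 1" "t \<in> slice" "w = e *\<^sub>R vertex a b l + (1 - e) *\<^sub>R t"
    using supported_by_decompose[OF vertex_in_slice[OF lab] mem s] .
  have "w = vertex a b l"
  proof (cases "vertex a b l = t")
    case True
    then show ?thesis using et by (simp flip: scaleR_add_left)
  next
    case False
    then have "w \<in> open_segment t (vertex a b l)"
      using et by (auto simp: in_segment intro!: exI[of _ e])
    then show ?thesis using w et(3) vertex_in_slice[OF lab] by (auto simp: extreme_point_of_def)
  qed
  with lab that show thesis by blast
qed

section \<open>The Kostka polytope equals the slice\<close>

lemma mass_nonneg_of_decreasing:
  fixes x :: "real ^ 'n::{finite,linorder}"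
  assumes dec: "\<And>i j. i \<le> j \<Longrightarrow> x $ j \<le> x $ i" and nonneg: "\<And>i. 0 \<le> x $ i"
    and k: "k \<in> {1..CARD('n)}"
  shows "0 \<le> mass x k"
proof -
  obtain i :: 'n where i: "position i = k" using ex_position[of k] k by auto
  \<comment> \<open>The top mass is the last entry, so nonnegativity applies; every other mass is a
    difference of neighbouring entries.\<close>
  show ?thesis
  proof (cases "k = CARD('n)")
    case True
    then have "prefix_sum x (Suc k) = prefix_sum x k" by (simp add: prefix_sum_top)
    then show ?thesis using prefix_sum_position[of x i] nonneg[of i] by (simp add: mass_def i)
  next
    case False
    then obtain j :: 'n where j: "position j = Suc k" using ex_position[of "Suc k", where 'n='n] k by auto
    then have "i \<le> j" using i position_le_iff[of i j] by simp
    then show ?thesis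
      using dec[of i j] prefix_sum_position[of x i] prefix_sum_position[of x j] by (simp add: mass_def i j)
  qed
qed

lemma prefix_sum_of_nat:
  "prefix_sum (\<chi> i. real (p $ i)) (position k) = real (\<Sum>i | i \<le> k. p $ i)"
  by (simp add: prefix_sum_def position_le_iff)

lemma total_of_nat:
  "prefix_sum ((\<chi> i. real (p $ i)) :: real ^ 'n::{finite,linorder}) CARD('n) = real (\<Sum>i\<in>UNIV. p $ i)"
  by (simp add: prefix_sum_top)

text \<open>The conditions define a convex set, so it is enough to verify them on the generating
  integer points.\<close>

lemma kostka_cone_halfspaces:
  fixes w :: "'n::{finite,linorder} point"
  assumes "w \<in> kostka_cone"
  shows "gap w CARD('n) = 0 \<and>
    (\<forall>k\<in>{1..CARD('n)}. 0 \<le> mass (fst w) k \<and> 0 \<le> mass (snd w) k \<and> 0 \<le> gap w k)"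
proof -
  let ?K = "{w :: 'n point. gap w CARD('n) = 0 \<and>
    (\<forall>k\<in>{1..CARD('n)}. 0 \<le> mass (fst w) k \<and> 0 \<le> mass (snd w) k \<and> 0 \<le> gap w k)}"
  have "convex ?K"
    by (rule convexI) (auto simp: functional_simps)
  moreover have "kostka_point p q \<in> ?K" if pq: "p \<in> Par n" "q \<in> Par n" "dominates p q" for p q :: "(nat, 'n) vec" and n
  proof -
    have "0 \<le> mass (\<chi> i. real (p $ i)) k" "0 \<le> mass (\<chi> i. real (q $ i)) k" if "k \<in> {1..CARD('n)}" for k
      using pq(1,2) that by (auto simp: Par_def intro!: mass_nonneg_of_decreasing)
    moreover have "0 \<le> gap (kostka_point p q) k" if k: "k \<in> {1..CARD('n)}" for k
    proof -
      obtain i :: 'n where i: "position i = k" using ex_position[of k] k by auto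
      have "(\<Sum>j | j \<le> i. q $ j) \<le> (\<Sum>j | j \<le> i. p $ j)"
        using pq(3) by (simp add: dominates_def)
      then show ?thesis
        unfolding gap_def kostka_point_def i[symmetric] fst_conv snd_conv prefix_sum_of_nat by linarith
    qed
    moreover have "gap (kostka_point p q) CARD('n) = 0"
      using pq(1,2) unfolding gap_def kostka_point_def fst_conv snd_conv total_of_nat by (simp add: Par_def)
    ultimately show ?thesis by (simp add: kostka_point_def)
  qed
  ultimately have "kostka_cone \<subseteq> ?K"
    unfolding kostka_cone_def by (intro hull_minimal) auto
  with assms show ?thesis by blast
qed

text \<open>Phrases membership through \<open>gap\<close>, so that the explicit gaps of the ray
  vectors can be used directly.\<close>

lemma kostka_point_in_cone:
  fixes p q :: "nat ^ 'n::{finite,linorder}"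
  assumes p: "\<And>i j. i \<le> j \<Longrightarrow> p $ j \<le> p $ i" and q: "\<And>i j. i \<le> j \<Longrightarrow> q $ j \<le> q $ i"
    and gap: "\<And>k. 0 \<le> gap (kostka_point p q) k" and total: "gap (kostka_point p q) CARD('n) = 0"
  shows "kostka_point p q \<in> kostka_cone"
proof -
  have "(\<Sum>i\<in>UNIV. q $ i) = (\<Sum>i\<in>UNIV. p $ i)"
    using total unfolding gap_def kostka_point_def fst_conv snd_conv total_of_nat by linarith
  then have "p \<in> Par (\<Sum>i\<in>UNIV. p $ i)" "q \<in> Par (\<Sum>i\<in>UNIV. p $ i)"
    using p q by (auto simp: Par_def)
  moreover have "dominates p q"
    unfolding dominates_def
  proof
    fix k
    show "(\<Sum>i | i \<le> k. q $ i) \<le> (\<Sum>i | i \<le> k. p $ i)"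
      using gap[of "position k"] unfolding gap_def kostka_point_def fst_conv snd_conv prefix_sum_of_nat by linarith
  qed
  ultimately show ?thesis unfolding kostka_cone_def by (blast intro: hull_inc)
qed

text \<open>The cone is given as a convex hull containing the origin, so shrinking is a convex
  combination with 0.\<close>

lemma scale_in_kostka_cone:
  fixes w :: "'n::{finite,linorder} point"
  assumes "w \<in> kostka_cone" "0 \<le> c" "c \<le> 1"
  shows "c *\<^sub>R w \<in> kostka_cone"
proof -
  have "kostka_point 0 (0 :: (nat, 'n) vec) \<in> kostka_cone"
    by (rule kostka_point_in_cone) (auto simp: kostka_point_def gap_def)
  moreover have "kostka_point 0 (0 :: (nat, 'n) vec) = 0"
    by (simp add: kostka_point_def vec_eq_iff prod_eq_iff)
  ultimately have "c *\<^sub>R w + (1 - c) *\<^sub>R 0 \<in> kostka_cone"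
    using assms unfolding kostka_cone_def by (intro convexD[OF convex_convex_hull]) auto
  then show ?thesis by simp
qed

text \<open>A vertex is a pair of integer partitions scaled by a factor of at most 1.\<close>

lemma vertex_in_kostka_cone:
  assumes lab: "is_label CARD('n) a b l"
  shows "(vertex a b l :: 'n::{finite,linorder} point) \<in> kostka_cone"
proof (cases "a = b")
  case True
  let ?p = "\<chi> i. if position i \<le> a then 1 else 0 :: (nat, 'n) vec"
  have "kostka_point ?p ?p \<in> kostka_cone"
    by (rule kostka_point_in_cone) (auto simp: kostka_point_def gap_def dest: position_le_iff[THEN iffD2])
  moreover have "kostka_point ?p ?p = (weight a, weight a)"
    by (auto simp: kostka_point_def weight_def vec_eq_iff)
  ultimately show ?thesis
    using True lab by (auto simp: vertex_def is_label_def simp del: scaleR_Pair intro!: scale_in_kostka_cone)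
next
  case False
  then have ab: "l < b" "b < a" "a \<le> CARD('n)" using lab by (auto simp: is_label_def)
  let ?p = "\<chi> i. if position i \<le> b then a - l else 0 :: (nat, 'n) vec"
  let ?q = "\<chi> i. if position i \<le> l then a - l else if position i \<le> a then b - l else 0 :: (nat, 'n) vec"
  have eq: "kostka_point ?p ?q = ray_vector a b l"
    using ab by (auto simp: kostka_point_def ray_vector_def vec_eq_iff of_nat_diff)
  have "kostka_point ?p ?q \<in> kostka_cone"
  proof (rule kostka_point_in_cone)
    show "?p $ j \<le> ?p $ i" "?q $ j \<le> ?q $ i" if "i \<le> j" for i j
      using position_le_iff[of i j] that ab by auto
    show "0 \<le> gap (kostka_point ?p ?q) k" for k
      unfolding eq using ab by (auto simp: gap_ray_vector)
    show "gap (kostka_point ?p ?q) CARD('n) = 0"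
      unfolding eq using ab by (simp add: gap_ray_vector)
  qed
  then have R: "(ray_vector a b l :: 'n point) \<in> kostka_cone" by (simp only: eq)
  have "1 \<le> real b" "1 \<le> real a - real l" using ab by auto
  then have "1 * 1 \<le> real b * (real a - real l)" by (intro mult_mono) auto
  then have "1 / (2 * real b * (real a - real l)) \<le> 1" by (simp add: divide_le_eq)
  then show ?thesis
    using False ab unfolding vertex_def by (auto intro!: scale_in_kostka_cone[OF R])
qed

text \<open>The inequalities give one inclusion. For the other, the compact convex slice is the hull
  of its extreme points, and these are vertices lying in the cone.\<close>

lemma kostka_polytope_eq_slice: "kostka_polytope = (slice :: 'n::{finite,linorder} point set)"
proof
  have total: "(\<Sum>i\<in>UNIV. fst w $ i + snd w $ i) = prefix_sum (fst w) CARD('n) + prefix_sum (snd w) CARD('n)"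
    for w :: "'n point"
    by (simp add: prefix_sum_top sum.distrib)
  have poly: "kostka_polytope = kostka_cone \<inter> {w :: 'n point. prefix_sum (fst w) CARD('n) + prefix_sum (snd w) CARD('n) = 1}"
    unfolding kostka_polytope_def total[symmetric] by auto
  show "kostka_polytope \<subseteq> (slice :: 'n point set)"
  proof
    fix w :: "'n point" assume "w \<in> kostka_polytope"
    then have "w \<in> kostka_cone" "prefix_sum (fst w) CARD('n) + prefix_sum (snd w) CARD('n) = 1"
      by (auto simp: poly)
    with kostka_cone_halfspaces[of w] show "w \<in> slice"
      by (auto simp: slice_def gap_def)
  qed
  have "{w :: 'n point. w extreme_point_of slice} \<subseteq> kostka_cone"
  proof
    fix w :: "'n point" assume "w \<in> {w. w extreme_point_of slice}"
    then obtain a b l where "is_label CARD('n) a b l" "w = vertex a b l"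
      using extreme_point_of_slice[of w] by auto
    then show "w \<in> kostka_cone" by (simp add: vertex_in_kostka_cone)
  qed
  moreover have "convex (kostka_cone :: 'n point set)"
    unfolding kostka_cone_def by (rule convex_convex_hull)
  ultimately have "convex hull {w :: 'n point. w extreme_point_of slice} \<subseteq> kostka_cone"
    by (rule hull_minimal)
  then have "slice \<subseteq> (kostka_cone :: 'n point set)"
    by (simp only: Krein_Milman_Minkowski[OF compact_slice convex_slice, symmetric])
  then show "slice \<subseteq> (kostka_polytope :: 'n point set)"
    by (auto simp: poly slice_def)
qed

text \<open>A point on the ray is fixed by its first half summing to 1/2. In the degenerate case
  every \<open>m\<close> gives a multiple of \<open>(weight a, weight a)\<close>.\<close>

lemma labeled_vertex:
  fixes u :: "'n::{finite,linorder} point"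
  assumes u: "u \<in> slice" and "labeled u (a, b, l)"
  shows "is_label CARD('n) a b l" "u = vertex a b l"
proof -
  have half: "prefix_sum (fst u) CARD('n) = 1 / 2" using u by (simp add: slice_def)
  consider "l < b" "b < a" "a \<le> CARD('n)" "u \<in> cone hull {ray_vector a b l}"
    | m where "b = a" "l = a" "a \<le> CARD('n)" "m < a" "u \<in> cone hull {ray_vector a a m}"
    using assms(2) unfolding labeled_def by blast
  then have "is_label CARD('n) a b l \<and> u = vertex a b l"
  proof cases
    case 1
    then obtain c where c: "u = c *\<^sub>R ray_vector a b l" by (auto simp: cone_hull_expl simp del: scaleR_Pair split_paired_Ex)
    have "c * ((real a - real l) * real b) = 1 / 2"
      using half 1 by (simp add: c ray_vector_eq functional_simps prefix_sum_weight)
    then have "c = 1 / (2 * real b * (real a - real l))"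
      using 1 by (simp add: field_simps)
    then show ?thesis using 1 c by (simp add: is_label_def vertex_def)
  next
    case 2
    then obtain c where c: "u = c *\<^sub>R ray_vector a a m" by (auto simp: cone_hull_expl simp del: scaleR_Pair split_paired_Ex)
    then have c': "u = (c * (real a - real m)) *\<^sub>R (weight a, weight a)"
      using 2 by (simp add: ray_vector_eq)
    have "c * (real a - real m) * real a = 1 / 2"
      using half 2 by (simp add: c' functional_simps prefix_sum_weight)
    then have "c * (real a - real m) = 1 / (2 * real a)"
      using 2 by (simp add: field_simps)
    then show ?thesis using 2 c' by (simp add: is_label_def vertex_def)
  qed
  then show "is_label CARD('n) a b l" "u = vertex a b l" by auto
qed

text \<open>If a combination of two nonnegative numbers with positive coefficients vanishes, both
  vanish; so an inequality tight inside a segment is tight at its ends.\<close>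

lemma face_of_supported_by:
  fixes m :: "'n::{finite,linorder} point"
  shows "{w \<in> slice. supported_by w m} face_of slice"
  unfolding face_of_def
proof (intro conjI ballI impI)
  show "convex {w \<in> slice. supported_by w m}"
    by (intro convexI) (simp add: convexD[OF convex_slice] supported_by_def functional_simps)
next
  fix x y w :: "'n point"
  assume x: "x \<in> slice" and y: "y \<in> slice" and w: "w \<in> {w \<in> slice. supported_by w m}"
    and seg: "w \<in> open_segment x y"
  obtain t where t: "0 < t" "t < 1" "w = (1 - t) *\<^sub>R x + t *\<^sub>R y"
    using seg by (auto simp: in_segment)
  have zero: "f = 0 \<and> g = 0" if "(1 - t) * f + t * g = 0" "0 \<le> f" "0 \<le> g" for f g :: real
  proof -
    have "(1 - t) * f \<ge> 0" "t * g \<ge> 0" using t that by auto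
    then have "(1 - t) * f = 0" "t * g = 0" using that by linarith+
    then show ?thesis using t by simp
  qed
  have vanish:
      "mass (fst m) k = 0 \<Longrightarrow> mass (fst x) k = 0 \<and> mass (fst y) k = 0"
      "mass (snd m) k = 0 \<Longrightarrow> mass (snd x) k = 0 \<and> mass (snd y) k = 0"
      "gap m k = 0 \<Longrightarrow> gap x k = 0 \<and> gap y k = 0" if k: "k \<in> {1..CARD('n)}" for k
  proof -
    have nonneg: "0 \<le> mass (fst x) k" "0 \<le> mass (snd x) k" "0 \<le> gap x k"
      "0 \<le> mass (fst y) k" "0 \<le> mass (snd y) k" "0 \<le> gap y k"
      using x y k unfolding slice_def by blast+
    have w_zero: "mass (fst m) k = 0 \<Longrightarrow> mass (fst w) k = 0"
      "mass (snd m) k = 0 \<Longrightarrow> mass (snd w) k = 0" "gap m k = 0 \<Longrightarrow> gap w k = 0"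
      using w k unfolding supported_by_def by blast+
    show "mass (fst m) k = 0 \<Longrightarrow> mass (fst x) k = 0 \<and> mass (fst y) k = 0"
      "mass (snd m) k = 0 \<Longrightarrow> mass (snd x) k = 0 \<and> mass (snd y) k = 0"
      "gap m k = 0 \<Longrightarrow> gap x k = 0 \<and> gap y k = 0"
      using zero[OF _ nonneg(1,4)] zero[OF _ nonneg(2,5)] zero[OF _ nonneg(3,6)]
        w_zero[unfolded t(3) fst_add snd_add fst_scaleR snd_scaleR functional_simps] by blast+
  qed
  then have "supported_by x m \<and> supported_by y m"
    unfolding supported_by_def by blast
  then show "x \<in> {w \<in> slice. supported_by w m}" "y \<in> {w \<in> slice. supported_by w m}"
    using x y by auto
qed auto

section \<open>Edges\<close>

text \<open>The supports of the third label lie in the union of those of the first two. Position 0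
  is exempt, as it carries no mass.\<close>

definition label_between :: "nat \<times> nat \<times> nat \<Rightarrow> nat \<times> nat \<times> nat \<Rightarrow> nat \<times> nat \<times> nat \<Rightarrow> bool" where
  "label_between = (\<lambda>(a, b, l) (a', b', l') (A, B, L).
     (B = b \<or> B = b') \<and>
     (\<forall>k>0. k = A \<or> k = L \<longrightarrow> k = a \<or> k = l \<or> k = a' \<or> k = l') \<and>
     (\<forall>k. L < k \<and> k < A \<longrightarrow> l < k \<and> k < a \<or> l' < k \<and> k < a'))"

definition edge_labels :: "nat \<times> nat \<times> nat \<Rightarrow> nat \<times> nat \<times> nat \<Rightarrow> bool" where
  "edge_labels = (\<lambda>(a, b, l) (a', b', l').
    (a = b \<and> (a' = b' \<or> a = b' \<or> a \<ge> a' \<or> l' \<ge> a)) \<or>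
    (a \<noteq> b \<and>
      ((a = a' \<and> b = b' \<or> a = a' \<and> l = l' \<or> b = b' \<and> l = l') \<or> l \<ge> a' \<or> l' \<ge> a)))"

text \<open>The integers strictly between \<open>L\<close> and \<open>A\<close> must be covered by
  two open intervals whose endpoints are the only candidates for \<open>L\<close> and
  \<open>A\<close>, apart from \<open>L = 0\<close>.\<close>

lemma label_between_edge:
  assumes "is_label r a b l" "is_label r a' b' l'" "is_label r A B L"
    and "a - b \<le> a' - b'" "edge_labels (a, b, l) (a', b', l')"
    and "label_between (a, b, l) (a', b', l') (A, B, L)"
  shows "(A, B, L) = (a, b, l) \<or> (A, B, L) = (a', b', l')"
proof -
  have B: "B = b \<or> B = b'"
    and A: "A = a \<or> A = l \<or> A = a' \<or> A = l'"
    and L: "L = 0 \<or> L = a \<or> L = l \<or> L = a' \<or> L = l'"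
    and I: "L < k \<and> k < A \<Longrightarrow> l < k \<and> k < a \<or> l' < k \<and> k < a'" for k
  proof -
    have "A > 0" and "\<And>k. k > 0 \<Longrightarrow> k = A \<or> k = L \<Longrightarrow> k = a \<or> k = l \<or> k = a' \<or> k = l'"
      using assms(3,6) by (auto simp: label_between_def is_label_def)
    then show "A = a \<or> A = l \<or> A = a' \<or> A = l'" "L = 0 \<or> L = a \<or> L = l \<or> L = a' \<or> L = l'"
      by blast+
    show "B = b \<or> B = b'" "L < k \<and> k < A \<Longrightarrow> l < k \<and> k < a \<or> l' < k \<and> k < a'" for k
      using assms(6) by (auto simp: label_between_def)
  qed
  have lab: "L < B \<and> B < A \<or> A = B \<and> L = B \<and> 0 < B" using assms(3) by (auto simp: is_label_def)
  have lab': "l' < b' \<and> b' < a' \<or> a' = b' \<and> l' = b' \<and> 0 < b'" using assms(2) by (auto simp: is_label_def)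
  show ?thesis
  proof (cases "a = b")
    case True
    then have l: "l = a" "b = a" using assms(1) by (auto simp: is_label_def)
    have cond: "a' = b' \<or> a = b' \<or> a \<ge> a' \<or> l' \<ge> a"
      using assms(5) True by (auto simp: edge_labels_def)
    show ?thesis
    proof (cases "L < B \<and> B < A")
      case lt: True
      \<comment> \<open>As \<open>l = a\<close>, the first interval is empty, so the second one
        covers everything. The point \<open>a\<close> could interfere only if it lay strictly
        between \<open>l'\<close> and \<open>a'\<close> and differed from \<open>b'\<close>.\<close>
      then have B': "l' < B" "B < a'" using I[of B] l by auto
      then have l': "l' < b'" "b' < a'" using lab' by linarith+
      have L_ge: "l' \<le> L" using I[of l'] lt l B' by linarith
      have A_le: "A \<le> a'" using I[of a'] lt l B' by linarith
      have "a = b' \<or> a \<ge> a' \<or> l' \<ge> a" using cond l' by linarith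
      then have b': "B = b'" using B l B' by linarith
      have "A = a'" using A
      proof (elim disjE)
        assume "A = a"
        then show ?thesis using cond lt A_le B' b' l' by linarith
      qed (use l lt b' cond A_le B' l' in linarith)+
      moreover have "L = l'" using L
      proof (elim disjE)
        assume "L = a"
        then show ?thesis using cond lt L_ge B' b' l' by linarith
      qed (use l lt b' cond L_ge B' l' in linarith)+
      ultimately show ?thesis using b' by simp
    next
      case False
      then have eq: "A = B" "L = B" using lab by auto
      have "B = a \<or> a' = b' \<or> l' < b' \<and> b' < a' \<and> B = b'" using B l lab' by linarith
      then show ?thesis
      proof (elim disjE)
        assume "l' < b' \<and> b' < a' \<and> B = b'"
        then show ?thesis using A eq l by auto
      qed (use B l eq lab' in auto)
    qed
  next
    case False
    \<comment> \<open>Here \<open>0 < a - b \<le> a' - b'\<close>, so the second label is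
      nondegenerate as well.\<close>
    then have ord: "l < b" "b < a" "l' < b'" "b' < a'"
      using assms(1,2,4) by (auto simp: is_label_def)
    have cond: "(a = a' \<and> b = b' \<or> a = a' \<and> l = l' \<or> b = b' \<and> l = l') \<or> l \<ge> a' \<or> l' \<ge> a"
      using assms(5) False by (auto simp: edge_labels_def)
    \<comment> \<open>A degenerate third label would place mass of the second component at
      \<open>B\<close>.\<close>
    have "B \<noteq> a" "B \<noteq> a'" "B \<noteq> l" "B \<noteq> l'"
      using B ord cond by auto
    then have lt: "L < B" "B < A" using lab A by auto
    from cond show ?thesis
    proof (elim disjE[of "_ \<or> _ \<or> _"])
      assume cond: "a = a' \<and> b = b' \<or> a = a' \<and> l = l' \<or> b = b' \<and> l = l'"
      then have around: "l < B" "l' < B" "B < a" "B < a'" using B ord by auto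
      \<comment> \<open>Both intervals contain \<open>B\<close>, so their union is an interval
        starting at \<open>min l l'\<close>; this also absorbs the default
        \<open>L = 0\<close>.\<close>
      have "min l l' \<le> L" using I[of "min l l'"] lt around by linarith
      then have "L = l \<or> L = l'" using L lt around by linarith
      moreover have "A = a \<or> A = a'" using A lt around by linarith
      ultimately show ?thesis using cond B by auto
    next
      assume cond: "l \<ge> a' \<or> l' \<ge> a"
      \<comment> \<open>The intervals are disjoint, so the third one stays within the one that
        contains \<open>B\<close>.\<close>
      show ?thesis
      proof (cases "B = b")
        case True
        have "l \<le> L" using I[of l] cond lt ord True by linarith
        moreover have "A \<le> a" using I[of a] cond lt ord True by linarith
        moreover have "L = l" using L calculation cond lt ord True by linarith
        moreover have "A = a" using A calculation cond lt ord True by linarith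
        ultimately show ?thesis using True by simp
      next
        case False
        then have b': "B = b'" using B by simp
        have "l' \<le> L" using I[of l'] cond lt ord b' by linarith
        moreover have "A \<le> a'" using I[of a'] cond lt ord b' by linarith
        moreover have "L = l'" using L calculation cond lt ord b' by linarith
        moreover have "A = a'" using A calculation cond lt ord b' by linarith
        ultimately show ?thesis using b' by simp
      qed
    qed
  qed
qed

text \<open>The witness mixes the two labels. If \<open>a = b\<close>, the point \<open>a\<close>
  inside the second interval replaces \<open>b'\<close>; if \<open>b = b'\<close>, the ends
  \<open>a\<close> and \<open>l'\<close> are combined; otherwise the intervals overlap and their
  union is used with \<open>b\<close> or \<open>b'\<close>. If both of the last choices were old
  labels, then \<open>a = a'\<close> and \<open>l = l'\<close>.\<close>

lemma ex_label_between:
  assumes "is_label r a b l" "is_label r a' b' l'"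
    and "a - b \<le> a' - b'" "\<not> edge_labels (a, b, l) (a', b', l')"
  obtains A B L where "is_label r A B L" "label_between (a, b, l) (a', b', l') (A, B, L)"
    "(A, B, L) \<noteq> (a, b, l)" "(A, B, L) \<noteq> (a', b', l')"
proof (cases "a = b")
  case True
  with assms have "is_label r a' a l'" "label_between (a, b, l) (a', b', l') (a', a, l')"
      "(a', a, l') \<noteq> (a, b, l)" "(a', a, l') \<noteq> (a', b', l')"
    by (auto simp: is_label_def edge_labels_def label_between_def)
  then show thesis by (rule that)
next
  case False
  then have ord: "l < b" "b < a" "l' < b'" "b' < a'" "a \<le> r" "a' \<le> r"
    and overlap: "l < a'" "l' < a"
    using assms by (auto simp: is_label_def edge_labels_def)
  show thesis
  proof (cases "b = b'")
    case True
    with False ord assms have "is_label r a b l'" "label_between (a, b, l) (a', b', l') (a, b, l')"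
      "(a, b, l') \<noteq> (a, b, l)" "(a, b, l') \<noteq> (a', b', l')"
      by (auto simp: is_label_def edge_labels_def label_between_def)
    then show thesis by (rule that)
  next
    case bb: False
    let ?A = "max a a'" and ?L = "min l l'"
    have "is_label r ?A b ?L" "is_label r ?A b' ?L"
      using ord by (auto simp: is_label_def)
    moreover have "label_between (a, b, l) (a', b', l') (?A, b, ?L)"
      "label_between (a, b, l) (a', b', l') (?A, b', ?L)"
      using overlap by (auto simp: label_between_def)
    moreover have "(?A, b, ?L) \<noteq> (a, b, l) \<or> (?A, b', ?L) \<noteq> (a', b', l')"
      using assms(4) False by (auto simp: edge_labels_def max_def min_def split: if_splits)
    ultimately show thesis using that bb by blast
  qed
qed

section \<open>Passage between labels and faces\<close>

text \<open>All functionals are nonnegative at vertices, so the support of an inner point of the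
  segment is the union of the supports of its ends, whatever \<open>e\<close> is.\<close>

lemma supported_by_vertex_segment_iff:
  assumes lab: "is_label CARD('n::{finite,linorder}) a b l" "is_label CARD('n) a' b' l'" "is_label CARD('n) A B L"
    and e: "0 < e" "e < 1"
  shows "supported_by (vertex A B L) (e *\<^sub>R vertex a b l + (1 - e) *\<^sub>R vertex a' b' l' :: 'n point) \<longleftrightarrow>
    label_between (a, b, l) (a', b', l') (A, B, L)"
proof -
  have zero: "e * f + (1 - e) * g = 0 \<longleftrightarrow> f = 0 \<and> g = 0" if "0 \<le> f" "0 \<le> g" for f g :: real
    using e that by (simp add: add_nonneg_eq_0_iff)
  let ?m = "e *\<^sub>R vertex a b l + (1 - e) *\<^sub>R vertex a' b' l' :: 'n point"
  have m: "mass (fst ?m) k = 0 \<longleftrightarrow> k \<noteq> b \<and> k \<noteq> b'"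
      "mass (snd ?m) k = 0 \<longleftrightarrow> k \<noteq> a \<and> k \<noteq> l \<and> k \<noteq> a' \<and> k \<noteq> l'"
      "gap ?m k = 0 \<longleftrightarrow> \<not> (l < k \<and> k < a \<or> l' < k \<and> k < a')" if "1 \<le> k" for k
    using that lab(1,2)
    by (simp_all only: fst_add snd_add fst_scaleR snd_scaleR functional_simps zero
        mass_fst_vertex mass_snd_vertex gap_vertex) auto
  have "supported_by (vertex A B L) ?m \<longleftrightarrow> (\<forall>k\<in>{1..CARD('n)}.
      (k = B \<longrightarrow> k = b \<or> k = b') \<and> (k = A \<or> k = L \<longrightarrow> k = a \<or> k = l \<or> k = a' \<or> k = l') \<and>
      (L < k \<and> k < A \<longrightarrow> l < k \<and> k < a \<or> l' < k \<and> k < a'))"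
    unfolding supported_by_def
    by (intro ball_cong refl) (use lab(3) in \<open>auto simp only: atLeastAtMost_iff m mass_fst_vertex mass_snd_vertex gap_vertex\<close>)
  also have "\<dots> \<longleftrightarrow> label_between (a, b, l) (a', b', l') (A, B, L)"
    (is "(\<forall>k\<in>_. ?P k \<and> ?Q k \<and> ?R k) \<longleftrightarrow> _")
  proof -
    have B: "B \<in> {1..CARD('n)}" and le: "A \<le> CARD('n)" "L \<le> CARD('n)"
      using lab(3) by (auto simp: is_label_def)
    have range: "k \<in> {1..CARD('n)}" if "k > 0 \<and> (k = A \<or> k = L) \<or> L < k \<and> k < A" for k
      using that le by auto
    have "label_between (a, b, l) (a', b', l') (A, B, L) \<longleftrightarrow>
        ?P B \<and> (\<forall>k>0. ?Q k) \<and> (\<forall>k. ?R k)"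
      unfolding label_between_def prod.case by blast
    moreover have "(\<forall>k\<in>{1..CARD('n)}. ?P k) \<longleftrightarrow> ?P B" using B by blast
    moreover have "(\<forall>k\<in>{1..CARD('n)}. ?Q k) \<longleftrightarrow> (\<forall>k>0. ?Q k)"
      using range by (metis atLeastAtMost_iff less_le_trans zero_less_one)
    moreover have "(\<forall>k\<in>{1..CARD('n)}. ?R k) \<longleftrightarrow> (\<forall>k. ?R k)" using range by blast
    ultimately show ?thesis by (simp only: ball_conj_distrib)
  qed
  finally show ?thesis .
qed

text \<open>The supports determine the label; \<open>l = 0\<close> shows as the absence of a second
  support point.\<close>

lemma vertex_eq_iff:
  assumes "is_label CARD('n) a b l" "is_label CARD('n) a' b' l'"
  shows "(vertex a b l :: 'n::{finite,linorder} point) = vertex a' b' l' \<longleftrightarrow> (a, b, l) = (a', b', l')"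
proof
  assume eq: "(vertex a b l :: 'n point) = vertex a' b' l'"
  have ge: "1 \<le> b" "1 \<le> a" "1 \<le> a'" using assms by (auto simp: is_label_def)
  have "b = b'"
    using mass_fst_vertex(2)[OF assms(1) ge(1)] mass_fst_vertex(2)[OF assms(2) ge(1)] eq by simp
  have q: "(k = a \<or> k = l) \<longleftrightarrow> (k = a' \<or> k = l')" if "1 \<le> k" for k
    using mass_snd_vertex(2)[OF assms(1) that] mass_snd_vertex(2)[OF assms(2) that] unfolding eq by blast
  have "a = a'"
    using q[OF ge(2)] q[OF ge(3)] \<open>b = b'\<close> assms by (auto simp: is_label_def)
  have "l = l'"
    using q[of l] q[of l'] \<open>a = a'\<close> \<open>b = b'\<close> assms by (cases l; cases l') (auto simp: is_label_def)
  then show "(a, b, l) = (a', b', l')" using \<open>a = a'\<close> \<open>b = b'\<close> by simp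
qed simp

text \<open>Otherwise a third vertex is supported by the midpoint of the edge and so lies in
  \<open>F\<close>, which is the segment. As it is not known to be extreme, it has to be excluded
  from the inside of the segment by comparing supports.\<close>

lemma edge_imp_edge_labels:
  assumes lab: "is_label CARD('n) a b l" "is_label CARD('n) a' b' l'"
    and le: "a - b \<le> a' - b'"
    and F: "F face_of slice"
    and ext: "{x. x extreme_point_of F} = {vertex a b l, vertex a' b' l' :: 'n::{finite,linorder} point}"
  shows "edge_labels (a, b, l) (a', b', l')"
proof (rule ccontr)
  assume not_edge: "\<not> ?thesis"
  let ?u = "vertex a b l :: 'n point" and ?v = "vertex a' b' l' :: 'n point"
  obtain A B L where R: "is_label CARD('n) A B L" "label_between (a, b, l) (a', b', l') (A, B, L)"
    "(A, B, L) \<noteq> (a, b, l)" "(A, B, L) \<noteq> (a', b', l')"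
    using ex_label_between[OF lab le not_edge] .
  let ?w = "vertex A B L :: 'n point"
  have convF: "convex F" and compF: "compact F"
    using F face_of_imp_convex[OF F] face_of_imp_compact[OF convex_slice compact_slice F] convex_slice by blast+
  have uv: "?u \<in> F" "?v \<in> F" using ext by (auto simp: extreme_point_of_def)
  define m where "m = (1/2) *\<^sub>R ?u + (1 - 1/2) *\<^sub>R ?v"
  have m: "m \<in> F" unfolding m_def by (rule convexD[OF convF uv]) auto
  have slices: "m \<in> slice" "?w \<in> slice"
    using m F face_of_imp_subset vertex_in_slice[OF R(1)] by blast+
  have "supported_by ?w m"
    unfolding m_def by (subst supported_by_vertex_segment_iff) (use lab R in auto)
  then obtain e t where et: "0 < e" "e < 1" "t \<in> slice" "m = e *\<^sub>R ?w + (1 - e) *\<^sub>R t"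
    using supported_by_decompose[OF slices(2,1)] by blast
  have "?w \<in> F"
  proof (cases "?w = t")
    case True
    then show ?thesis using et m by (simp flip: scaleR_add_left)
  next
    case False
    then have "m \<in> open_segment t ?w" using et by (auto simp: in_segment intro!: exI[of _ e])
    then show ?thesis using F m et(3) slices(2) unfolding face_of_def by blast
  qed
  also have "F = convex hull {?u, ?v}"
    using Krein_Milman_Minkowski[OF compF convF] ext by simp
  finally have "?w \<in> closed_segment ?u ?v" by (simp add: segment_convex_hull)
  moreover have "?w \<noteq> ?u" "?w \<noteq> ?v" using R vertex_eq_iff lab by blast+
  ultimately have "?w \<in> open_segment ?v ?u"
    by (simp add: open_segment_def closed_segment_commute)
  then obtain s where s: "0 < s" "s < 1" "?w = s *\<^sub>R ?u + (1 - s) *\<^sub>R ?v"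
    by (auto simp: in_segment add.commute)
  \<comment> \<open>Being an inner point, \<open>?w\<close> supports both ends. Written as its own
    midpoint, it fits the criterion for segments.\<close>
  have between: "label_between (A, B, L) (A, B, L) (a, b, l)" "label_between (A, B, L) (A, B, L) (a', b', l')"
  proof -
    have w: "?w = (1/2) *\<^sub>R ?w + (1 - 1/2) *\<^sub>R ?w" by (simp flip: scaleR_add_left)
    have "supported_by ?u ?w" "supported_by ?v ?w"
      unfolding s(3) using lab s(1,2)
      by (simp_all add: supported_by_vertex_segment_iff) (auto simp: label_between_def)
    then show "label_between (A, B, L) (A, B, L) (a, b, l)" "label_between (A, B, L) (A, B, L) (a', b', l')"
      using supported_by_vertex_segment_iff[OF R(1) R(1) lab(1), of "1/2"]
        supported_by_vertex_segment_iff[OF R(1) R(1) lab(2), of "1/2"] w by simp_all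
  qed
  moreover have "a > 0" "a' > 0" using lab by (auto simp: is_label_def)
  ultimately have eq: "b = B" "b' = B" "a = A \<or> a = L" "a' = A \<or> a' = L"
    unfolding label_between_def prod.case by blast+
  show False
  proof (cases "a = b")
    case True
    then show ?thesis using not_edge eq(1,2) by (simp add: edge_labels_def)
  next
    case False
    then have "b < a" "b' < a'" using lab le by (auto simp: is_label_def)
    moreover have "L \<le> B" using R(1) by (auto simp: is_label_def)
    ultimately have "a = a'" using eq by linarith
    then show ?thesis using not_edge False eq(1,2) by (simp add: edge_labels_def)
  qed
qed

text \<open>The face is the smallest one containing the midpoint. Its extreme points are vertices
  supported by the midpoint, and no third label qualifies.\<close>

lemma edge_labels_imp_edge:
  assumes lab: "is_label CARD('n::{finite,linorder}) a b l" "is_label CARD('n) a' b' l'"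
    and le: "a - b \<le> a' - b'"
    and ext: "(vertex a b l :: 'n point) extreme_point_of slice"
      "(vertex a' b' l' :: 'n point) extreme_point_of slice"
    and edge: "edge_labels (a, b, l) (a', b', l')"
  shows "\<exists>F. F face_of slice \<and> {x. x extreme_point_of F} = {vertex a b l, vertex a' b' l' :: 'n point}"
proof -
  let ?u = "vertex a b l :: 'n point" and ?v = "vertex a' b' l' :: 'n point"
  define m where "m = (1/2) *\<^sub>R ?u + (1 - 1/2) *\<^sub>R ?v"
  let ?F = "{w \<in> slice. supported_by w m}"
  have F: "?F face_of slice" by (rule face_of_supported_by)
  have iff: "supported_by (vertex A B L) m \<longleftrightarrow> label_between (a, b, l) (a', b', l') (A, B, L)"
    if "is_label CARD('n) A B L" for A B L
    unfolding m_def by (subst supported_by_vertex_segment_iff) (use lab that in auto)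
  have "x extreme_point_of ?F \<longleftrightarrow> x = ?u \<or> x = ?v" for x
  proof
    assume "x extreme_point_of ?F"
    then have x: "x extreme_point_of slice" "supported_by x m"
      using extreme_point_of_face[OF F, of x] by auto
    obtain A B L where R: "is_label CARD('n) A B L" "x = vertex A B L"
      using extreme_point_of_slice[OF x(1)] .
    then show "x = ?u \<or> x = ?v"
      using label_between_edge[OF lab R(1) le edge] iff[OF R(1)] x(2) by auto
  next
    assume "x = ?u \<or> x = ?v"
    moreover have "supported_by ?u m" "supported_by ?v m"
      using lab by (auto simp: iff) (auto simp: label_between_def)
    ultimately show "x extreme_point_of ?F"
      using ext vertex_in_slice[OF lab(1)] vertex_in_slice[OF lab(2)]
      by (auto simp: extreme_point_of_face[OF F])
  qed
  then have "{x. x extreme_point_of ?F} = {?u, ?v}"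
    by (intro set_eqI) (simp only: mem_Collect_eq insert_iff empty_iff simp_thms)
  with F show ?thesis by (intro exI[of _ ?F] conjI)
qed

theorem theorem4p5:
  fixes u v :: "(real ^ 'n::{finite,linorder}) \<times> (real ^ 'n::{finite,linorder})"
    and a b l a' b' l' :: nat
  assumes "u extreme_point_of kostka_polytope"
    and "v extreme_point_of kostka_polytope"
    and "u \<noteq> v"
    and "labeled u (a, b, l)"
    and "labeled v (a', b', l')"
    and "a - b \<le> a' - b'"
  shows "(\<exists>F. F face_of kostka_polytope \<and> {x. x extreme_point_of F} = {u, v}) \<longleftrightarrow>
    (a = b \<and> (a' = b' \<or> a = b' \<or> a \<ge> a' \<or> l' \<ge> a)) \<or>
    (a \<noteq> b \<and>
      ((a = a' \<and> b = b' \<or> a = a' \<and> l = l' \<or> b = b' \<and> l = l') \<or> l \<ge> a' \<or> l' \<ge> a))"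
proof -
  have ext: "u extreme_point_of slice" "v extreme_point_of slice"
    using assms(1,2) by (simp_all add: kostka_polytope_eq_slice)
  then have "u \<in> slice" "v \<in> slice" by (simp_all add: extreme_point_of_def)
  then have lab: "is_label CARD('n) a b l" "is_label CARD('n) a' b' l'"
    and uv: "u = vertex a b l" "v = vertex a' b' l'"
    using labeled_vertex assms(4,5) by blast+
  have "(\<exists>F. F face_of kostka_polytope \<and> {x. x extreme_point_of F} = {u, v}) \<longleftrightarrow>
      edge_labels (a, b, l) (a', b', l')"
    unfolding kostka_polytope_eq_slice uv
  proof
    assume "\<exists>F. F face_of slice \<and> {x. x extreme_point_of F} = {vertex a b l, vertex a' b' l' :: 'n point}"
    then obtain F where "F face_of slice" "{x. x extreme_point_of F} = {vertex a b l, vertex a' b' l' :: 'n point}"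
      by (elim exE conjE)
    then show "edge_labels (a, b, l) (a', b', l')"
      by (rule edge_imp_edge_labels[OF lab assms(6)])
  next
    assume "edge_labels (a, b, l) (a', b', l')"
    then show "\<exists>F. F face_of slice \<and> {x. x extreme_point_of F} = {vertex a b l, vertex a' b' l' :: 'n point}"
      by (rule edge_labels_imp_edge[OF lab assms(6) ext[unfolded uv]])
  qed
  then show ?thesis by (simp only: edge_labels_def prod.case)
qed

end
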